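(* A marked permutation $\tau^{*}$ is insertable if and only if $\tau^{*} = \tau^{*}(\Pi)$ for some ordered set partition $\Pi$ (of the set of entries of $\tau^*$).
   Context: A marked permutation is a word of distinct positive integers ("cars") with some entries marked. A run of a word is a maximal contiguous increasing subword; runs of a marked permutation are those of the underlying word. Parking functions: a Dyck path of size $n$ goes from $(0,0)$ to $(n,n)$ with unit North/East steps weakly above $y=x$; a parking function is such a path with distinct positive cars, one in the cell immediately right of each North step, increasing upward in each column; the cell with lower-left corner $(i,j)$ lies in the $(j-i)$-diagonal; left/right refers to columns. A valley is an East step immediately followed by a North step such that the cell directly below the East step has no car or has a car smaller than the car next to that North step. A (valley-)marked parking function has a subset of valleys marked; the car next to a marked valley's North step is marked. Algorithm A, $\operatorname{Insert}(PF,c,k)$ (for $c\notin PF$, $(k+1)$-diagonal of $PF$ empty, $k$-diagonal containing no car smaller than $c$): the set of parking functions obtained by (1) for each car $s<c$ in the $(k-1)$-diagonal: move all cars in rows higher than $s$ up and right by one and place $c$ directly above $s$ (insert $NE$ after $s$'s North step, $c$ at the new North step); (2) for each car $b>c$ in the $k$-diagonal: move all cars in higher rows than $b$ up and right by one and place $c$ directly above and right of $b$ (insert $EN$ after $b$'s North step, $c$ at the new North step); (3) if $k=0$: move all cars up and right by one and put $c$ in the lower-left corner (prepend $NE$). Algorithm B, $\operatorname{Insert}^{*}(MPF,c,k)$ (for $c\notin MPF$, $k$-diagonal containing no marked car smaller than $c$): for each unmarked car $s<c$ in the $k$-diagonal and each unmarked car $b>c$ in the $(k+1)$-diagonal, look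 to the right of this car for the next time that either an unmarked car $b'>c$ appears in the $(k+1)$-diagonal or the path returns to the line $y=x+k$ (for $s$ with nothing directly above it, the latter happens immediately). In the first case shift $b'$ and every car in a higher row up and right by one and place a marked $c$ directly under $b'$; in the second case move all cars above this point up and right by one and place a marked $c$ in the cell directly right of and above this point (in the $k$-diagonal). The set of results is $\operatorname{Insert}^{*}(MPF,c,k)$. Insertion process for a marked permutation $\tau^*$ of length $n$: a car lying in the $(k+1)$-st run from the end of $\tau^*$ is inserted into the $k$-diagonal. Start with the set containing only the empty parking function. Process the unmarked cars of $\tau^*$ from right to left, replacing the current set $S$ by $\bigcup_{P\in S}\operatorname{Insert}(P,c,k)$; then process the marked cars of $\tau^*$ from right to left, replacing $S$ by $\bigcup_{P\in S}\operatorname{Insert}^{*}(P,c,k)$ (an insertion whose hypotheses fail contributes nothing). $\tau^*$ is insertable if the final set (of marked parking functions of size $n$) is nonempty. Ordered set partitions and $\tau^*(\Pi)$: for an ordered set partition $\Pi=(B_1,\dots,B_m)$ of a finite set of positive integers, define a word $\tau(\Pi)$ recursively: if $m=1$, $\tau(\Pi)$ lists $B_1$ increasingly; otherwise let $\Pi'=(B_2,\dots,B_m)$ and $r$ the first letter of $\tau(\Pi')$; then $\tau(\Pi)$ is the elements of $B_1$ larger than $r$ in increasing order, followed by the elements of $B_1$ smaller than $r$ in increasing order, followed by $\tau(\Pi')$. The marked word $\tau^*(\Pi)$ is $\tau(\Pi)$ with every entry marked except the leftmost entry of each block's (contiguous) segment. *)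

theory Defs
  imports "HOL-Library.Disjoint_Sets"
begin

section \<open>Marked permutations and runs\<close>

text \<open>Words with marks; \<^const>\<open>True\<close> in the second component means that the entry is marked.\<close>

type_synonym marked_word = "(nat \<times> bool) list"

definition marked_permutation :: "marked_word \<Rightarrow> bool" where
  "marked_permutation t \<longleftrightarrow> distinct (map fst t) \<and> (\<forall>c \<in> set (map fst t). 0 < c)"

fun runs :: "nat list \<Rightarrow> nat list list" where
  "runs [] = []"
| "runs (x # xs) =
     (case runs xs of
        [] \<Rightarrow> [[x]]
      | r # rs \<Rightarrow> if x < hd r then (x # r) # rs else [x] # r # rs)"

lemma concat_runs: "concat (runs w) = w"
  by (induction w) (auto split: list.splits)

lemma runs_nonempty: "[] \<notin> set (runs w)"
  by (induction w) (auto split: list.splits)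

lemma runs_increasing: "r \<in> set (runs w) \<Longrightarrow> sorted_wrt (<) r"
proof (induction w arbitrary: r)
  case Nil
  then show ?case by simp
next
  case (Cons x xs)
  show ?case
  proof (cases "runs xs")
    case Nil
    then show ?thesis using Cons.prems by simp
  next
    case (Cons q qs)
    have "q \<noteq> []" and q: "sorted_wrt (<) q"
      using runs_nonempty[of xs] Cons.IH[of q] Cons by auto
    then obtain y ys where y: "q = y # ys" by (cases q) auto
    show ?thesis
      using Cons.prems Cons.IH Cons q y by (auto split: if_splits) (meson less_trans)
  qed
qed

lemma runs_maximal: "successively (\<lambda>r r'. \<not> last r < hd r') (runs w)"
proof (induction w)
  case Nil
  then show ?case by simp
next
  case (Cons x xs)
  then show ?case
    using runs_nonempty[of xs] by (cases "runs xs") (auto simp: successively_Cons)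
qed

text \<open>The number \<open>k\<close> such that \<open>c\<close> lies in the \<open>(k+1)\<close>-st run from the end of \<open>w\<close>.\<close>

definition run_from_end :: "nat list \<Rightarrow> nat \<Rightarrow> nat" where
  "run_from_end w c = (THE k. k < length (runs w) \<and> c \<in> set (rev (runs w) ! k))"


section \<open>Marked parking functions\<close>

text \<open>
  A labelled path is the word of its steps, starting at the origin; each North step carries the car
  to its right and the information whether this car is marked.
  Unmarked parking functions are those without marked cars.
\<close>

datatype step = East | North (car: nat) (marked: bool)

text \<open>
  The value of \<open>y - x\<close> at the end point \<open>(x, y)\<close> of a path. A North step starting at
  \<open>(x, y)\<close> has its car in the cell with lower-left corner \<open>(x, y)\<close>, so in
  \<open>xs @ North c m # ys\<close> the car \<open>c\<close> lies in the \<open>height xs\<close>-diagonal.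
\<close>

definition height :: "step list \<Rightarrow> int" where
  "height P = (\<Sum>s\<leftarrow>P. case s of East \<Rightarrow> - 1 | North _ _ \<Rightarrow> 1)"

definition cars :: "step list \<Rightarrow> nat set" where
  "cars P = {c. \<exists>m. North c m \<in> set P}"

definition diagonal :: "step list \<Rightarrow> int \<Rightarrow> (nat \<times> bool) set" where
  "diagonal P d = {(c, m). \<exists>xs ys. P = xs @ North c m # ys \<and> height xs = d}"

definition dyck_path :: "step list \<Rightarrow> bool" where
  "dyck_path P \<longleftrightarrow> (\<forall>xs ys. P = xs @ ys \<longrightarrow> 0 \<le> height xs) \<and> height P = 0"

definition columns_increasing :: "step list \<Rightarrow> bool" where
  "columns_increasing P \<longleftrightarrow>
     (\<forall>xs ys a b m m'. P = xs @ North a m # North b m' # ys \<longrightarrow> a < b)"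

text \<open>
  \<open>valley us c\<close>: a North step with car \<open>c\<close> following the path \<open>us\<close> completes a valley.
  The cell directly below the East step of the valley contains a car if and only if this
  East step is preceded by a North step, namely the car of the latter.
\<close>

definition valley :: "step list \<Rightarrow> nat \<Rightarrow> bool" where
  "valley us c \<longleftrightarrow>
     (\<exists>xs. us = xs @ [East] \<and> (\<forall>xs' d m. xs = xs' @ [North d m] \<longrightarrow> d < c))"

definition marked_parking_function :: "nat \<Rightarrow> step list \<Rightarrow> bool" where
  "marked_parking_function n P \<longleftrightarrow>
     length P = 2 * n \<and> dyck_path P \<and> columns_increasing P \<and>
     distinct (map car (filter (\<lambda>s. s \<noteq> East) P)) \<and> (\<forall>c \<in> cars P. 0 < c) \<and>
     (\<forall>us c ys. P = us @ North c True # ys \<longrightarrow> valley us c)"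

definition parking_function :: "nat \<Rightarrow> step list \<Rightarrow> bool" where
  "parking_function n P \<longleftrightarrow>
     marked_parking_function n P \<and> (\<forall>c m. North c m \<in> set P \<longrightarrow> \<not> m)"


section \<open>Insertion\<close>

text \<open>
  Shifting all later cars up and right by one amounts to inserting one North and one East step
  into the path. Both insertions return the empty set if their hypotheses fail.
\<close>

definition insert_unmarked :: "step list \<Rightarrow> nat \<Rightarrow> nat \<Rightarrow> step list set" where
  "insert_unmarked P c k =
     (if c \<notin> cars P \<and> diagonal P (int k + 1) = {} \<and> (\<forall>(d, m) \<in> diagonal P (int k). \<not> d < c)
      then {xs @ North s m # North c False # East # ys | xs s m ys.
              P = xs @ North s m # ys \<and> height xs = int k - 1 \<and> s < c}
         \<union> {xs @ North b m # East # North c False # ys | xs b m ys.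
              P = xs @ North b m # ys \<and> height xs = int k \<and> c < b}
         \<union> (if k = 0 then {North c False # East # P} else {})
      else {})"

text \<open>
  The two events searched for in the insertion of a marked car, for a path
  split into the part \<open>us\<close> already traversed and the rest \<open>zs\<close>.
\<close>

definition meets_bigger :: "nat \<Rightarrow> nat \<Rightarrow> step list \<Rightarrow> step list \<Rightarrow> bool" where
  "meets_bigger c k us zs \<longleftrightarrow>
     height us = int k + 1 \<and> (\<exists>b zs'. zs = North b False # zs' \<and> c < b)"

definition on_line :: "nat \<Rightarrow> step list \<Rightarrow> bool" where
  "on_line k us \<longleftrightarrow> height us = int k"

text \<open>
  The search begins right after the North step of the car \<open>a\<close>, so a car directly above
  \<open>a\<close> is eligible; \<open>ys\<close> is the part of the path traversed until the first event.
\<close>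

definition insert_marked :: "step list \<Rightarrow> nat \<Rightarrow> nat \<Rightarrow> step list set" where
  "insert_marked P c k =
     (if c \<notin> cars P \<and> (\<forall>(d, m) \<in> diagonal P (int k). \<not> (m \<and> d < c))
      then {us @ (if on_line k us then [North c True, East] else [East, North c True]) @ zs
              | us zs xs a ys.
              P = us @ zs \<and> us = xs @ North a False # ys \<and>
              (height xs = int k \<and> a < c \<or> height xs = int k + 1 \<and> c < a) \<and>
              (meets_bigger c k us zs \<or> on_line k us) \<and>
              (\<forall>ys1 ys2. ys = ys1 @ ys2 \<and> ys2 \<noteq> [] \<longrightarrow>
                 \<not> meets_bigger c k (xs @ North a False # ys1) (ys2 @ zs) \<and>
                 \<not> on_line k (xs @ North a False # ys1))}
      else {})"

definition insert_all ::
    "(step list \<Rightarrow> nat \<Rightarrow> nat \<Rightarrow> step list set) \<Rightarrow> (nat \<Rightarrow> nat) \<Rightarrow> nat list \<Rightarrow>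
     step list set \<Rightarrow> step list set" where
  "insert_all ins k cs S = fold (\<lambda>c S. \<Union>P\<in>S. ins P c (k c)) cs S"

definition insertion_result :: "marked_word \<Rightarrow> step list set" where
  "insertion_result t =
     (let k = run_from_end (map fst t);
          us = map fst (filter (\<lambda>x. \<not> snd x) t);
          ms = map fst (filter snd t)
      in insert_all insert_marked k (rev ms) (insert_all insert_unmarked k (rev us) {[]}))"

definition insertable :: "marked_word \<Rightarrow> bool" where
  "insertable t \<longleftrightarrow> insertion_result t \<noteq> {}"


section \<open>Ordered set partitions\<close>

definition ordered_set_partition :: "nat set \<Rightarrow> nat set list \<Rightarrow> bool" where
  "ordered_set_partition A Bs \<longleftrightarrow> finite A \<and> distinct Bs \<and> partition_on A (set Bs)"

text \<open>The empty set has the empty ordered set partition, whose word is empty.\<close>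

fun segments :: "nat set list \<Rightarrow> nat list list" where
  "segments [] = []"
| "segments [B] = [sorted_list_of_set B]"
| "segments (B # C # Bs) =
     (let r = hd (concat (segments (C # Bs)))
      in (sorted_list_of_set {x \<in> B. r < x} @ sorted_list_of_set {x \<in> B. x < r})
         # segments (C # Bs))"

definition tau :: "nat set list \<Rightarrow> nat list" where
  "tau Bs = concat (segments Bs)"

fun mark_tail :: "nat list \<Rightarrow> marked_word" where
  "mark_tail [] = []"
| "mark_tail (x # xs) = (x, False) # map (\<lambda>y. (y, True)) xs"

definition tau_star :: "nat set list \<Rightarrow> marked_word" where
  "tau_star Bs = concat (map mark_tail (segments Bs))"

lemma map_fst_tau_star: "map fst (tau_star Bs) = tau Bs"
proof -
  have "map fst (mark_tail xs) = xs" for xs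
    by (cases xs) (auto simp: comp_def)
  then show ?thesis
    by (simp add: tau_star_def tau_def map_concat comp_def)
qed

lemma tau_simps:
  "tau [B] = sorted_list_of_set B"
  "tau (B # C # Bs) =
     sorted_list_of_set {x \<in> B. hd (tau (C # Bs)) < x} @
     sorted_list_of_set {x \<in> B. x < hd (tau (C # Bs))} @ tau (C # Bs)"
  by (simp_all add: tau_def Let_def)


section \<open>Insertion yields marked parking functions\<close>

lemma height_simps [simp]:
  "height [] = 0"
  "height (East # P) = height P - 1"
  "height (North c m # P) = height P + 1"
  "height (P @ Q) = height P + height Q"
  by (simp_all add: height_def)

fun nonneg_from :: "int \<Rightarrow> step list \<Rightarrow> bool" where
  "nonneg_from h [] \<longleftrightarrow> 0 \<le> h"
| "nonneg_from h (s # P) \<longleftrightarrow> 0 \<le> h \<and> nonneg_from (h + height [s]) P"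

lemma height_Cons: "height (s # P) = height [s] + height P"
  by (cases s) auto

lemma nonneg_from_iff: "(\<forall>xs ys. P = xs @ ys \<longrightarrow> 0 \<le> h + height xs) \<longleftrightarrow> nonneg_from h P"
proof (induction P arbitrary: h)
  case Nil
  then show ?case by simp
next
  case (Cons s P)
  have "(\<forall>xs ys. s # P = xs @ ys \<longrightarrow> 0 \<le> h + height xs) \<longleftrightarrow>
        0 \<le> h \<and> (\<forall>xs ys. P = xs @ ys \<longrightarrow> 0 \<le> h + height (s # xs))"
    by (auto simp: Cons_eq_append_conv)
  also have "\<dots> \<longleftrightarrow> 0 \<le> h \<and> (\<forall>xs ys. P = xs @ ys \<longrightarrow> 0 \<le> (h + height [s]) + height xs)"
    by (subst height_Cons) (simp add: add.assoc)
  finally show ?case using Cons.IH by simp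
qed

lemma nonneg_from_append:
  "nonneg_from h (P @ Q) \<longleftrightarrow> nonneg_from h P \<and> nonneg_from (h + height P) Q"
proof (induction P arbitrary: h)
  case Nil
  show ?case by (cases Q) auto
next
  case (Cons s P)
  then show ?case by (subst height_Cons) (simp add: add.assoc)
qed

lemma dyck_path_iff: "dyck_path P \<longleftrightarrow> nonneg_from 0 P \<and> height P = 0"
  using nonneg_from_iff[of P 0] by (simp add: dyck_path_def)

lemma nonneg_from_ge: "nonneg_from h Q \<Longrightarrow> 0 \<le> h"
  by (cases Q) auto

lemma dyck_path_insert_NE: "dyck_path (P @ Q) \<Longrightarrow> dyck_path (P @ North c m # East # Q)"
  by (auto simp: dyck_path_iff nonneg_from_append dest: nonneg_from_ge)

lemma dyck_path_insert_EN:
  "dyck_path (P @ Q) \<Longrightarrow> 1 \<le> height P \<Longrightarrow> dyck_path (P @ East # North c m # Q)"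
  by (auto simp: dyck_path_iff nonneg_from_append)

fun column_ok :: "step \<Rightarrow> step \<Rightarrow> bool" where
  "column_ok (North a _) (North b _) \<longleftrightarrow> a < b"
| "column_ok _ _ \<longleftrightarrow> True"

lemma columns_increasing_iff: "columns_increasing P \<longleftrightarrow> successively column_ok P"
proof
  assume "columns_increasing P"
  then show "successively column_ok P"
  proof (induction P)
    case Nil
    then show ?case by simp
  next
    case (Cons s P)
    have "columns_increasing P"
      using Cons.prems unfolding columns_increasing_def by (metis append_Cons)
    moreover have "column_ok s (hd P)" if "P \<noteq> []"
    proof (cases "\<exists>a m b m'. s = North a m \<and> hd P = North b m'")
      case True
      then obtain a m b m' where s: "s = North a m" "hd P = North b m'" by blast
      then have "s # P = [] @ North a m # North b m' # tl P" using that by (cases P) auto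
      then have "a < b" using Cons.prems unfolding columns_increasing_def by blast
      then show ?thesis using s by simp
    next
      case False
      then show ?thesis by (cases s; cases "hd P") auto
    qed
    ultimately show ?case using Cons.IH by (auto simp: successively_Cons)
  qed
next
  assume "successively column_ok P"
  then show "columns_increasing P"
    by (auto simp: columns_increasing_def successively_append_iff)
qed

lemma cars_simps [simp]:
  "cars [] = {}" "cars (East # P) = cars P" "cars (North c m # P) = insert c (cars P)"
  "cars (P @ Q) = cars P \<union> cars Q"
  by (auto simp: cars_def)

lemma cars_eq: "cars P = car ` {s \<in> set P. s \<noteq> East}"
proof (induction P)
  case (Cons s P)
  have "{s' \<in> set (s # P). s' \<noteq> East} =
        (if s = East then {} else {s}) \<union> {s' \<in> set P. s' \<noteq> East}" by auto
  then show ?case using Cons.IH by (cases s) auto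
qed simp

lemma parking_function_insert_unmarked:
  assumes P: "parking_function n P" and c: "0 < c" and Q: "Q \<in> insert_unmarked P c k"
  shows "parking_function (Suc n) Q"
proof -
  have hyps: "c \<notin> cars P" "diagonal P (int k + 1) = {}"
    and Q': "(\<exists>xs s m ys. Q = xs @ North s m # North c False # East # ys \<and>
                P = xs @ North s m # ys \<and> height xs = int k - 1 \<and> s < c) \<or>
             (\<exists>xs b m ys. Q = xs @ North b m # East # North c False # ys \<and>
                P = xs @ North b m # ys \<and> height xs = int k \<and> c < b) \<or>
             Q = North c False # East # P"
    using Q unfolding insert_unmarked_def by (auto split: if_splits)
  have unm: "\<forall>c m. North c m \<in> set P \<longrightarrow> \<not> m" and P': "marked_parking_function n P"
    using P by (auto simp: parking_function_def)
  have len: "length P = 2 * n" and dp: "dyck_path P" and ci: "successively column_ok P"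
    and di: "distinct (map car (filter (\<lambda>s. s \<noteq> East) P))" and pos: "\<forall>c \<in> cars P. 0 < c"
    using P' by (auto simp: marked_parking_function_def columns_increasing_iff)
  have main: "length Q = 2 * Suc n \<and> dyck_path Q \<and> successively column_ok Q \<and>
     distinct (map car (filter (\<lambda>s. s \<noteq> East) Q)) \<and> (\<forall>c \<in> cars Q. 0 < c) \<and>
     (\<forall>c m. North c m \<in> set Q \<longrightarrow> \<not> m)"
    using Q'
  proof (elim disjE exE conjE)
    fix xs s m ys
    assume *: "Q = xs @ North s m # North c False # East # ys" "P = xs @ North s m # ys"
      "height xs = int k - 1" "s < c"
    have "dyck_path Q" using dyck_path_insert_NE[of "xs @ [North s m]" ys c False] dp * by simp
    moreover have "successively column_ok Q"
      using ci * by (auto simp: successively_append_iff successively_Cons)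
    ultimately show ?thesis
      using * hyps len di pos c unm by (auto simp: cars_eq)
  next
    fix xs b m ys
    assume *: "Q = xs @ North b m # East # North c False # ys" "P = xs @ North b m # ys"
      "height xs = int k" "c < b"
    have "dyck_path Q" using dyck_path_insert_EN[of "xs @ [North b m]" ys c False] dp * by simp
    moreover have "successively column_ok Q"
    proof -
      have "hd ys = East" if "ys \<noteq> []"
      proof (cases "hd ys")
        case (North d m')
        then have "P = (xs @ [North b m]) @ North d m' # tl ys" using * that by (cases ys) auto
        moreover have "height (xs @ [North b m]) = int k + 1" using * by simp
        ultimately have "(d, m') \<in> diagonal P (int k + 1)" unfolding diagonal_def by blast
        then show ?thesis using hyps by simp
      qed simp
      then show ?thesis
        using ci * by (auto simp: successively_append_iff successively_Cons)
    qed
    ultimately show ?thesis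
      using * hyps len di pos c unm by (auto simp: cars_eq)
  next
    assume *: "Q = North c False # East # P"
    have "dyck_path Q" using dyck_path_insert_NE[of "[]" P c False] dp * by simp
    moreover have "successively column_ok Q"
      using ci * by (auto simp: successively_Cons)
    ultimately show ?thesis
      using * hyps len di pos c unm by (auto simp: cars_eq)
  qed
  then have "\<forall>us c ys. Q = us @ North c True # ys \<longrightarrow> valley us c"
    by (metis in_set_conv_decomp)
  with main show ?thesis
    unfolding parking_function_def marked_parking_function_def columns_increasing_iff by blast
qed

fun marks_ok :: "step list \<Rightarrow> step list \<Rightarrow> bool" where
  "marks_ok us [] \<longleftrightarrow> True"
| "marks_ok us (s # P) \<longleftrightarrow>
     (\<forall>c. s = North c True \<longrightarrow> valley us c) \<and> marks_ok (us @ [s]) P"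

lemma marks_ok_iff:
  "(\<forall>us c ys. P = us @ North c True # ys \<longrightarrow> valley (vs @ us) c) \<longleftrightarrow> marks_ok vs P"
proof (induction P arbitrary: vs)
  case Nil
  then show ?case by simp
next
  case (Cons s P)
  have "(\<forall>us c ys. s # P = us @ North c True # ys \<longrightarrow> valley (vs @ us) c) \<longleftrightarrow>
     (\<forall>c. s = North c True \<longrightarrow> valley vs c) \<and>
     (\<forall>us c ys. P = us @ North c True # ys \<longrightarrow> valley ((vs @ [s]) @ us) c)"
    by (auto simp: Cons_eq_append_conv)
  then show ?case using Cons.IH[of "vs @ [s]"] by simp
qed

lemma marks_ok_append: "marks_ok us (P @ Q) \<longleftrightarrow> marks_ok us P \<and> marks_ok (us @ P) Q"
  by (induction P arbitrary: us) auto

lemma valley_local: "valley (us @ [s, s']) c \<longleftrightarrow> valley [s, s'] c"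
  by (cases s; cases s') (auto simp: valley_def append_eq_Cons_conv)

lemma marks_ok_local: "marks_ok (us @ [s, s']) P \<longleftrightarrow> marks_ok [s, s'] P"
proof (induction P arbitrary: us s s')
  case Nil
  then show ?case by simp
next
  case (Cons t P)
  have "marks_ok (us @ [s, s', t]) P \<longleftrightarrow> marks_ok [s', t] P"
    using Cons.IH[of "us @ [s]" s' t] by simp
  moreover have "marks_ok [s, s', t] P \<longleftrightarrow> marks_ok [s', t] P"
    using Cons.IH[of "[s]" s' t] by simp
  ultimately show ?case using valley_local[of us s s'] by simp
qed

lemma marks_ok_change:
  assumes "marks_ok us Q"
    and "\<And>c Q'. Q = North c True # Q' \<Longrightarrow> valley vs c"
    and "\<And>s c Q'. Q = s # North c True # Q' \<Longrightarrow> valley (us @ [s]) c \<Longrightarrow> valley (vs @ [s]) c"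
  shows "marks_ok vs Q"
proof (cases Q)
  case Nil
  then show ?thesis by simp
next
  case (Cons s Q')
  show ?thesis
  proof (cases Q')
    case Nil
    then show ?thesis using Cons assms by auto
  next
    case (Cons s' Q'')
    have "marks_ok (us @ [s, s']) Q'' \<longleftrightarrow> marks_ok (vs @ [s, s']) Q''"
      using marks_ok_local[of us] marks_ok_local[of vs] by simp
    then show ?thesis using Cons \<open>Q = s # Q'\<close> assms by auto
  qed
qed

lemma marked_parking_function_insert_marked:
  assumes P: "marked_parking_function n P" and c: "0 < c" and Q: "Q \<in> insert_marked P c k"
  shows "marked_parking_function (Suc n) Q"
proof -
  have hyp: "c \<notin> cars P \<and> (\<forall>(d, m) \<in> diagonal P (int k). \<not> (m \<and> d < c))"
  proof (rule ccontr)
    assume "\<not> ?thesis"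
    then show False using Q unfolding insert_marked_def by (simp only: if_False empty_iff)
  qed
  then have hyps: "c \<notin> cars P" "\<forall>(d, m) \<in> diagonal P (int k). \<not> (m \<and> d < c)" by simp_all
  obtain us zs xs a ys where
    Qeq: "Q = us @ (if on_line k us then [North c True, East] else [East, North c True]) @ zs"
    and Peq: "P = us @ zs" and us: "us = xs @ North a False # ys"
    and a: "height xs = int k \<and> a < c \<or> height xs = int k + 1 \<and> c < a"
    and ev: "meets_bigger c k us zs \<or> on_line k us"
    and mini': "\<forall>ys1 ys2. ys = ys1 @ ys2 \<and> ys2 \<noteq> [] \<longrightarrow>
                 \<not> meets_bigger c k (xs @ North a False # ys1) (ys2 @ zs) \<and>
                 \<not> on_line k (xs @ North a False # ys1)"
    using Q unfolding insert_marked_def if_P[OF hyp] mem_Collect_eq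
    by (elim exE conjE) (rule that)
  have mini: "\<not> on_line k (xs @ North a False # ys1)" if "ys = ys1 @ ys2" "ys2 \<noteq> []" for ys1 ys2
    using mini' that by blast
  have len: "length P = 2 * n" and dp: "dyck_path P" and ci: "successively column_ok P"
    and di: "distinct (map car (filter (\<lambda>s. s \<noteq> East) P))" and pos: "\<forall>c \<in> cars P. 0 < c"
    and mk: "marks_ok [] P"
    using P marks_ok_iff[of P "[]"] by (auto simp: marked_parking_function_def columns_increasing_iff)
  have above: "int k < height (xs @ North a False # ys1)" if "ys = ys1 @ ys2" "ys2 \<noteq> []" for ys1 ys2
    using that
  proof (induction ys1 arbitrary: ys2 rule: rev_induct)
    case Nil
    then show ?case using a by auto
  next
    case (snoc s ys1)
    have "int k < height (xs @ North a False # ys1)" using snoc by simp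
    moreover have "height (xs @ North a False # ys1 @ [s]) \<noteq> int k"
      using mini[of "ys1 @ [s]" ys2] snoc.prems by (simp add: on_line_def)
    ultimately show ?case by (cases s) auto
  qed
  have prev: "d < c" if "vs @ [North d m] = us \<or> vs @ [North d m, East] = us"
      "height (vs @ [North d m]) = int k + 1" for vs d m
  proof -
    have eq: "(\<exists>w. us = vs @ North d m # w)" using that by auto
    then obtain w where w: "us = vs @ North d m # w" by blast
    then consider "vs = xs" "a = d" | v where "xs = vs @ North d m # v" | v where "vs = xs @ North a False # v"
      using us by (auto simp: append_eq_append_conv2 Cons_eq_append_conv append_eq_Cons_conv)
    then show ?thesis
    proof cases
      case 1
      then show ?thesis using that a by auto
    next
      case 2
      then have "length w \<ge> 1 + length ys" using us w by auto
      moreover have "length w \<le> 1" "w = [] \<or> w = [East]" using that w by auto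
      ultimately have "w = [East] \<and> ys = []" by (cases ys) auto
      then show ?thesis using us w by auto
    next
      case 3
      then have "ys = v @ North d m # w" using us w by simp
      then have "int k < height (xs @ North a False # v)" using above by blast
      then show ?thesis using that 3 by simp
    qed
  qed
  have main: "dyck_path Q \<and> successively column_ok Q \<and> marks_ok [] Q"
  proof (cases "on_line k us")
    case True
    then have Q1: "Q = us @ North c True # East # zs" using Qeq by simp
    have hu: "height us = int k" using True by (simp add: on_line_def)
    have "ys \<noteq> []" using a us hu by auto
    then obtain ys' s where ys: "ys = ys' @ [s]" by (cases ys rule: rev_cases) auto
    have "int k < height (xs @ North a False # ys')" using above ys by blast
    then have s: "s = East" using hu us ys by (cases s) auto
    define u where "u = xs @ North a False # ys'"
    have u: "us = u @ [East]" using us ys s by (simp add: u_def)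
    have v: "valley us c"
      unfolding valley_def
    proof (intro exI[of _ u] conjI u allI impI)
      fix vs d m assume "u = vs @ [North d m]"
      then show "d < c" using prev[of vs d m] u hu by simp
    qed
    have "marks_ok (us @ [North c True, East]) zs"
    proof (rule marks_ok_change)
      show "marks_ok us zs" using mk Peq by (simp add: marks_ok_append)
    next
      fix d Q' assume zs: "zs = North d True # Q'"
      then have "(d, True) \<in> diagonal P (int k)" using Peq hu by (auto simp: diagonal_def)
      moreover have "d \<noteq> c" using hyps zs Peq by auto
      ultimately have "c < d" using hyps by fastforce
      then show "valley (us @ [North c True, East]) d" by (simp add: valley_local) (simp add: valley_def)
    next
      fix s d Q' assume "valley (us @ [s]) d"
      then show "valley ((us @ [North c True, East]) @ [s]) d"
        by (auto simp: valley_def)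
    qed
    moreover have "successively column_ok Q"
      using ci Q1 Peq u by (auto simp: successively_append_iff successively_Cons)
    ultimately show ?thesis
      using dyck_path_insert_NE[of us zs c True] dp mk v Peq Q1 by (auto simp: marks_ok_append)
  next
    case False
    then have Q1: "Q = us @ East # North c True # zs" using Qeq by simp
    obtain b zs' where hu: "height us = int k + 1" and zs: "zs = North b False # zs'" "c < b"
      using ev False by (auto simp: meets_bigger_def)
    have v: "valley (us @ [East]) c"
      using prev hu by (auto simp: valley_def)
    have "marks_ok (us @ [East, North c True]) zs"
    proof (rule marks_ok_change)
      show "marks_ok us zs" using mk Peq by (simp add: marks_ok_append)
    qed (use zs in \<open>auto simp: valley_def\<close>)
    moreover have "successively column_ok Q"
      using ci Q1 Peq zs by (auto simp: successively_append_iff successively_Cons)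
    ultimately show ?thesis
      using dyck_path_insert_EN[of us zs c True] dp mk v Peq Q1 hu by (auto simp: marks_ok_append)
  qed
  have "length Q = 2 * Suc n" "distinct (map car (filter (\<lambda>s. s \<noteq> East) Q))" "\<forall>c \<in> cars Q. 0 < c"
    using Qeq Peq len di pos c hyps(1) by (auto simp: cars_eq)
  then show ?thesis
    using main marks_ok_iff[of Q "[]"] by (simp add: marked_parking_function_def columns_increasing_iff)
qed

lemma insert_all_invariant:
  assumes "\<And>n P c Q. I n P \<Longrightarrow> 0 < c \<Longrightarrow> Q \<in> ins P c (k c) \<Longrightarrow> I (Suc n) Q"
    and "\<forall>c \<in> set cs. 0 < c" and "\<forall>P \<in> S. I n P"
  shows "\<forall>P \<in> insert_all ins k cs S. I (n + length cs) P"
  using assms(2,3)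
proof (induction cs arbitrary: S n)
  case Nil
  then show ?case by (simp add: insert_all_def)
next
  case (Cons c cs)
  have "\<forall>P \<in> (\<Union>P\<in>S. ins P c (k c)). I (Suc n) P"
    using Cons.prems assms(1) by fastforce
  then show ?case
    using Cons.IH[of "\<Union>P\<in>S. ins P c (k c)" "Suc n"] Cons.prems(1) by (simp add: insert_all_def)
qed

lemma insertion_result_marked_parking_function:
  assumes t: "marked_permutation t" and P: "P \<in> insertion_result t"
  shows "marked_parking_function (length t) P"
proof -
  define k us ms where "k = run_from_end (map fst t)" and
    "us = map fst (filter (\<lambda>x. \<not> snd x) t)" and "ms = map fst (filter snd t)"
  have pos: "\<forall>c \<in> set (rev us). 0 < c" "\<forall>c \<in> set (rev ms). 0 < c"
    using t by (auto simp: us_def ms_def marked_permutation_def)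
  have empty: "\<forall>P \<in> {[]}. parking_function 0 P"
    by (auto simp: parking_function_def marked_parking_function_def dyck_path_def columns_increasing_def)
  let ?S = "insert_all insert_unmarked k (rev us) {[]}"
  have "\<forall>P \<in> ?S. parking_function (0 + length (rev us)) P"
    by (rule insert_all_invariant[where I = parking_function, OF _ pos(1) empty]) (rule parking_function_insert_unmarked)
  then have "\<forall>P \<in> ?S. marked_parking_function (length us) P"
    by (simp add: parking_function_def)
  then have "\<forall>P \<in> insert_all insert_marked k (rev ms) ?S.
      marked_parking_function (length us + length (rev ms)) P"
    by (rule insert_all_invariant[where I = marked_parking_function, OF _ pos(2), rotated]) (rule marked_parking_function_insert_marked)
  moreover have "length us + length ms = length t"
    using sum_length_filter_compl[of snd t] by (simp add: us_def ms_def)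
  ultimately show ?thesis
    using P by (simp add: insertion_result_def Let_def k_def us_def ms_def)
qed

end

theory Submission
  imports Defs
begin

text \<open>
  Inserting a car never changes the diagonals of the others, so during the insertion process the
  content of every diagonal is known in advance. Since a run increases and later runs have smaller
  index, the hypotheses of both insertions always hold, and the search in the marked insertion
  always ends because the path returns to the main diagonal. Writing \<open>K c\<close> for the index of the run
  of \<open>c\<close>, insertability thus means that every unmarked \<open>c\<close> with \<open>K c > 0\<close> has a larger unmarked car
  in its run or a smaller one in the next run, and every marked \<open>c\<close> has a smaller unmarked car in
  its run or a larger one in the previous run. The condition on unmarked cars concerns only the next
  unmarked car to the right, and it says exactly that each segment has the shape prescribed by
  \<open>\<tau>\<^sup>*\<close>; given this, the condition on marked cars amounts to the first car being unmarked.
\<close>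

section \<open>Run indices\<close>

text \<open>For a suffix starting with a car, this is the number of runs after the one containing
  that car, and so a computable form of \<open>run_from_end\<close>. The truncated subtraction gives
  the empty word the value 0.\<close>

definition descents :: "nat list \<Rightarrow> nat" where
  "descents w = length (runs w) - 1"

lemma runs_eq_Nil_iff [simp]: "runs w = [] \<longleftrightarrow> w = []"
  by (cases w) (auto split: list.splits)

lemma hd_hd_runs: "w \<noteq> [] \<Longrightarrow> hd (hd (runs w)) = hd w"
  by (cases w) (auto split: list.splits)

lemma descents_singleton [simp]: "descents [x] = 0"
  by (simp add: descents_def)

lemma descents_Cons_Cons [simp]:
  "descents (x # y # w) = descents (y # w) + (if x < y then 0 else 1)"
proof -
  obtain r rs where r: "runs (y # w) = r # rs" using runs_eq_Nil_iff[of "y # w"] by (cases "runs (y # w)") (auto simp del: runs.simps(2))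
  then have "hd r = y" using hd_hd_runs[of "y # w"] by simp
  then show ?thesis using r by (simp add: descents_def del: runs.simps(2)) (simp add: runs.simps(2)[of x])
qed

lemma descents_Cons: "w \<noteq> [] \<Longrightarrow> descents (x # w) = descents w + (if x < hd w then 0 else 1)"
  by (cases w) simp_all

lemma descents_append_ge: "descents (d # ys) \<le> descents (xs @ d # ys)"
  by (induction xs) (auto simp: descents_Cons)

lemma hd_append_eq_hd_append_singleton: "hd (xs @ d # ys) = hd (xs @ [d])"
  by (cases xs) auto

lemma strict_sorted_Cons_hd:
  "w \<noteq> [] \<Longrightarrow> sorted_wrt (<) (x # w) \<longleftrightarrow> x < hd w \<and> sorted_wrt (<) w"
  for x :: nat
  by (cases w) (auto intro: less_trans)

text \<open>Each letter before \<open>d\<close> adds a break exactly when it is not smaller than its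
  successor. This characterises when \<open>d\<close> lies in the same run as the first letter,
  whatever follows \<open>d\<close>.\<close>

lemma descents_append_eq_iff:
  "descents (xs @ d # ys) = descents (d # ys) \<longleftrightarrow> sorted_wrt (<) (xs @ [d])"
proof (induction xs)
  case (Cons x xs)
  have "descents (d # ys) \<le> descents (xs @ d # ys)" by (rule descents_append_ge)
  moreover have "sorted_wrt (<) (x # (xs @ [d])) \<longleftrightarrow> x < hd (xs @ d # ys) \<and> sorted_wrt (<) (xs @ [d])"
    using strict_sorted_Cons_hd[of "xs @ [d]" x] hd_append_eq_hd_append_singleton[of xs d ys] by simp
  ultimately show ?case using Cons.IH by (auto simp: descents_Cons simp del: sorted_wrt.simps)
qed simp

lemma descents_eq_0_iff: "w \<noteq> [] \<Longrightarrow> descents w = 0 \<longleftrightarrow> sorted_wrt (<) w"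
  using descents_append_eq_iff[of "butlast w" "last w" "[]"] by simp

text \<open>Cut at the unique break before \<open>r\<close>. The part \<open>q\<close> is empty when
  the break is immediately before \<open>r\<close>, whereas \<open>p\<close> always contains the
  letter before the break.\<close>

lemma descents_append_eq_Suc:
  assumes "descents (xs @ r # ys) = descents (r # ys) + 1"
  shows "\<exists>p q. xs = p @ q \<and> p \<noteq> [] \<and> sorted_wrt (<) p \<and> sorted_wrt (<) (q @ [r])"
  using assms
proof (induction xs)
  case (Cons x xs)
  show ?case
  proof (cases "x < hd (xs @ r # ys)")
    case True
    then have "descents (xs @ r # ys) = descents (r # ys) + 1"
      using Cons.prems by (simp add: descents_Cons)
    then obtain p q where pq: "xs = p @ q" "p \<noteq> []" "sorted_wrt (<) p" "sorted_wrt (<) (q @ [r])"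
      using Cons.IH by blast
    then have "sorted_wrt (<) (x # p)"
      using True strict_sorted_Cons_hd[of p x] by simp
    with pq have "x # xs = (x # p) @ q \<and> x # p \<noteq> [] \<and> sorted_wrt (<) (x # p) \<and> sorted_wrt (<) (q @ [r])"
      by simp
    then show ?thesis by blast
  next
    case False
    then have "descents (xs @ r # ys) = descents (r # ys)"
      using Cons.prems by (simp add: descents_Cons)
    then have "sorted_wrt (<) (xs @ [r])" by (simp add: descents_append_eq_iff)
    then have "x # xs = [x] @ xs \<and> [x] \<noteq> [] \<and> sorted_wrt (<) [x] \<and> sorted_wrt (<) (xs @ [r])"
      by simp
    then show ?thesis by blast
  qed
qed simp

text \<open>The only break is between \<open>p\<close> and \<open>q @ [r]\<close>: the last letter
  of \<open>p\<close> exceeds \<open>r\<close>, while the increasing word \<open>q @ [r]\<close>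
  starts at or below \<open>r\<close>.\<close>

lemma descents_append_single_descent:
  assumes "p \<noteq> []" "sorted_wrt (<) p" "\<forall>y \<in> set p. r < y" "sorted_wrt (<) (q @ [r])"
  shows "descents (p @ q @ r # ys) = descents (r # ys) + 1"
  using assms(1-3)
proof (induction p)
  case (Cons x p)
  have q: "descents (q @ r # ys) = descents (r # ys)" using assms(4) by (simp add: descents_append_eq_iff)
  show ?case
  proof (cases p)
    case Nil
    have "hd (q @ r # ys) \<le> r" using assms(4) by (cases q) auto
    then show ?thesis using Nil q Cons.prems by (simp add: descents_Cons)
  next
    case (Cons y p')
    then show ?thesis using Cons.IH Cons.prems by simp
  qed
qed simp

section \<open>Runs counted from the end\<close>

lemma runs_append:
  "\<exists>A p. runs (xs @ c # ys) = A @ (p @ hd (runs (c # ys))) # tl (runs (c # ys))"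
proof (induction xs)
  case Nil
  have "runs (c # ys) = [] @ ([] @ hd (runs (c # ys))) # tl (runs (c # ys))"
    using runs_eq_Nil_iff[of "c # ys"] by (simp del: runs.simps(2))
  then show ?case unfolding append_Nil[of "c # ys"] by blast
next
  case (Cons x xs)
  then obtain A p where A: "runs (xs @ c # ys) = A @ (p @ hd (runs (c # ys))) # tl (runs (c # ys))"
    by blast
  show ?case
  proof (cases A)
    case Nil
    then show ?thesis
      using A by (simp del: runs.simps(2) add: runs.simps(2)[of x])
  next
    case (Cons a A')
    then show ?thesis
      using A by (simp del: runs.simps(2) add: runs.simps(2)[of x])
  qed
qed

text \<open>Supplies the uniqueness that the definite description in \<open>run_from_end\<close>
  requires.\<close>

lemma distinct_concat_nth_unique:
  assumes "distinct (concat xss)" "i < length xss" "j < length xss"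
    "c \<in> set (xss ! i)" "c \<in> set (xss ! j)"
  shows "i = j"
proof -
  have "i' = j'" if "i' < length xss" "j' < length xss" "c \<in> set (xss ! i')" "c \<in> set (xss ! j')" "i' \<le> j'"
    for i' j'
  proof (rule ccontr)
    assume "i' \<noteq> j'"
    then have j: "i' < j'" using that by simp
    have "xss = take j' xss @ xss ! j' # drop (Suc j') xss" using that by (simp add: id_take_nth_drop)
    then have "distinct (concat (take j' xss) @ xss ! j' @ concat (drop (Suc j') xss))"
      using assms(1) by (metis concat.simps(2) concat_append)
    moreover have "xss ! i' \<in> set (take j' xss)" using that j by (auto simp: in_set_conv_nth intro!: exI[of _ i'])
    ultimately show False using that by auto
  qed
  then show ?thesis using assms by (metis linear)
qed

text \<open>Letters put in front of \<open>c # ys\<close> extend its first run or create earlier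
  ones, but never touch the later runs. Hence the index of \<open>c\<close> from the end depends
  only on the suffix starting at \<open>c\<close>.\<close>

lemma run_from_end_eq_descents:
  assumes "distinct (xs @ c # ys)"
  shows "run_from_end (xs @ c # ys) c = descents (c # ys)"
proof -
  let ?w = "xs @ c # ys"
  obtain A p where A: "runs ?w = A @ (p @ hd (runs (c # ys))) # tl (runs (c # ys))"
    using runs_append by blast
  have "hd (runs (c # ys)) \<noteq> []"
    using runs_nonempty[of "c # ys"] by (metis list.set_sel(1) list.distinct(1) runs_eq_Nil_iff)
  then have c: "c \<in> set (hd (runs (c # ys)))"
    using hd_hd_runs[of "c # ys"] by (metis list.sel(1) list.set_sel(1) list.distinct(1))
  have k: "descents (c # ys) = length (tl (runs (c # ys)))" by (simp add: descents_def)
  have "descents (c # ys) < length (runs ?w)" using A k by simp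
  \<comment> \<open>Exactly \<open>descents (c # ys)\<close> runs follow the one containing
    \<open>c\<close>, and indices count from 0.\<close>
  moreover have "rev (runs ?w) ! descents (c # ys) = p @ hd (runs (c # ys))"
    using A k by (simp add: nth_append del: runs.simps(2))
  ultimately have P: "descents (c # ys) < length (runs ?w) \<and> c \<in> set (rev (runs ?w) ! descents (c # ys))"
    using c by simp
  have "distinct (concat (runs ?w))" using assms by (simp add: concat_runs)
  then have "k = k'" if "k < length (runs ?w) \<and> c \<in> set (rev (runs ?w) ! k)"
    "k' < length (runs ?w) \<and> c \<in> set (rev (runs ?w) ! k')" for k k'
    using distinct_concat_nth_unique[of "runs ?w" "length (runs ?w) - Suc k" "length (runs ?w) - Suc k'" c] that
    by (auto simp: rev_nth simp del: runs.simps(2))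
  then show ?thesis
    unfolding run_from_end_def using P by (intro the_equality) blast+
qed

lemma run_from_end_append:
  assumes "distinct (xs @ ys)" "c \<in> set ys"
  shows "run_from_end (xs @ ys) c = run_from_end ys c"
proof -
  obtain a b where "ys = a @ c # b" using assms(2) by (meson split_list)
  then show ?thesis
    using assms(1) run_from_end_eq_descents[of a c b] run_from_end_eq_descents[of "xs @ a" c b] by simp
qed

text \<open>The trace that "\<open>c\<close> stands to the left of \<open>d\<close>" leaves on run
  indices: the index is larger, or equal with a smaller value. All later arguments use positions
  only through this relation.\<close>

definition reading_order :: "(nat \<Rightarrow> nat) \<Rightarrow> nat \<Rightarrow> nat \<Rightarrow> bool" where
  "reading_order K c d \<longleftrightarrow> K d \<le> K c \<and> (K d = K c \<longrightarrow> c < d)"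

lemma reading_order_run_from_end:
  assumes "distinct w"
  shows "sorted_wrt (reading_order (run_from_end w)) w"
proof -
  \<comment> \<open>The induction runs over suffixes \<open>v\<close>, with the indices taken in the
    whole word \<open>w\<close> throughout.\<close>
  have "sorted_wrt (reading_order (run_from_end w)) v" if "w = u @ v" for u v
    using that
  proof (induction v arbitrary: u)
    case (Cons c v)
    have "reading_order (run_from_end w) c d" if d: "d \<in> set v" for d
    proof -
      obtain a b where v: "v = a @ d # b" using split_list[OF d] by blast
      have "run_from_end w c = descents ((c # a) @ d # b)"
        using run_from_end_eq_descents[of u c v] assms Cons.prems v by simp
      moreover have "run_from_end w d = descents (d # b)"
        using run_from_end_eq_descents[of "u @ c # a" d b] assms Cons.prems v by simp
      ultimately show ?thesis
        using descents_append_ge[of d b "c # a"] descents_append_eq_iff[of "c # a" d b]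
        by (auto simp: reading_order_def)
    qed
    moreover have "sorted_wrt (reading_order (run_from_end w)) v"
      using Cons.IH[of "u @ [c]"] Cons.prems by simp
    ultimately show ?case by simp
  qed simp
  then show ?thesis by (metis append_Nil)
qed

section \<open>Diagonals under insertion\<close>

lemma diagonal_Nil [simp]: "diagonal [] h = {}"
  by (simp add: diagonal_def)

lemma diagonal_Cons:
  "diagonal (s # P) h =
    diagonal P (h - height [s]) \<union> {(c, m). s = North c m \<and> h = 0}" (is "?L = ?R")
proof -
  have "(c, m) \<in> ?L \<longleftrightarrow> (c, m) \<in> ?R" for c m
  proof -
    have "(c, m) \<in> ?L \<longleftrightarrow> (\<exists>xs ys. s # P = xs @ North c m # ys \<and> height xs = h)"
      by (simp add: diagonal_def)
    also have "\<dots> \<longleftrightarrow> (s = North c m \<and> h = 0) \<or>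
        (\<exists>xs ys. P = xs @ North c m # ys \<and> height (s # xs) = h)"
      by (auto simp: Cons_eq_append_conv)
    also have "\<dots> \<longleftrightarrow> (c, m) \<in> ?R"
      unfolding diagonal_def by (subst height_Cons) (auto simp: algebra_simps)
    finally show ?thesis .
  qed
  then show ?thesis by auto
qed

lemma diagonal_East [simp]: "diagonal (East # P) h = diagonal P (h + 1)"
  by (simp add: diagonal_Cons)

lemma diagonal_North [simp]:
  "diagonal (North c m # P) h = diagonal P (h - 1) \<union> (if h = 0 then {(c, m)} else {})"
  by (auto simp: diagonal_Cons)

lemma diagonal_append [simp]: "diagonal (P @ Q) h = diagonal P h \<union> diagonal Q (h - height P)"
proof (induction P arbitrary: h)
  case (Cons s P)
  then show ?case by (cases s) (auto simp: algebra_simps)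
qed simp

text \<open>The inserted North and East steps cancel in height, so every other car keeps its
  diagonal. In all three cases the new North step starts at height \<open>k\<close>.\<close>

lemma insert_unmarked_invariant:
  assumes "Q \<in> insert_unmarked P c k"
  shows "height Q = height P" "cars Q = insert c (cars P)"
    "diagonal Q h = diagonal P h \<union> (if h = int k then {(c, False)} else {})"
proof -
  have "(\<exists>xs s m ys. Q = xs @ North s m # North c False # East # ys \<and>
                P = xs @ North s m # ys \<and> height xs = int k - 1) \<or>
             (\<exists>xs b m ys. Q = xs @ North b m # East # North c False # ys \<and>
                P = xs @ North b m # ys \<and> height xs = int k) \<or>
             Q = North c False # East # P \<and> k = 0"
    using assms unfolding insert_unmarked_def by (auto split: if_splits)
  then show "height Q = height P" "cars Q = insert c (cars P)"
    "diagonal Q h = diagonal P h \<union> (if h = int k then {(c, False)} else {})"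
    by (auto simp: algebra_simps split: if_splits)
qed

text \<open>Once the hypotheses of the insertion hold, each admissible car \<open>s\<close> or
  \<open>b\<close> really yields a path, as does the corner when \<open>k = 0\<close>.\<close>

lemma insert_unmarked_nonempty_iff:
  assumes "c \<notin> cars P" "diagonal P (int k + 1) = {}" "\<forall>(d, m) \<in> diagonal P (int k). \<not> d < c"
  shows "insert_unmarked P c k \<noteq> {} \<longleftrightarrow>
    k = 0 \<or> (\<exists>s m. (s, m) \<in> diagonal P (int k - 1) \<and> s < c) \<or>
    (\<exists>b m. (b, m) \<in> diagonal P (int k) \<and> c < b)"
proof -
  have s: "(\<exists>s m. (s, m) \<in> diagonal P (int k - 1) \<and> s < c) \<longleftrightarrow>
      {xs @ North s m # North c False # East # ys | xs s m ys.
        P = xs @ North s m # ys \<and> height xs = int k - 1 \<and> s < c} \<noteq> {}"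
    unfolding diagonal_def by blast
  have b: "(\<exists>b m. (b, m) \<in> diagonal P (int k) \<and> c < b) \<longleftrightarrow>
      {xs @ North b m # East # North c False # ys | xs b m ys.
        P = xs @ North b m # ys \<and> height xs = int k \<and> c < b} \<noteq> {}"
    unfolding diagonal_def by blast
  have union: "S \<union> T \<union> (if k = 0 then {z} else {}) \<noteq> {} \<longleftrightarrow> k = 0 \<or> S \<noteq> {} \<or> T \<noteq> {}"
    for S T :: "step list set" and z by auto
  show ?thesis
    unfolding s b insert_unmarked_def if_P[OF conjI[OF assms(1) conjI[OF assms(2,3)]]]
    by (rule union)
qed

lemma insert_marked_invariant:
  assumes "Q \<in> insert_marked P c k"
  shows "height Q = height P" "cars Q = insert c (cars P)"
    "diagonal Q h = diagonal P h \<union> (if h = int k then {(c, True)} else {})"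
proof -
  have "\<exists>us zs. Q = us @ (if on_line k us then [North c True, East] else [East, North c True]) @ zs \<and>
          P = us @ zs \<and> (meets_bigger c k us zs \<or> on_line k us)"
    using assms unfolding insert_marked_def by (auto split: if_split_asm)
  then show "height Q = height P" "cars Q = insert c (cars P)"
    "diagonal Q h = diagonal P h \<union> (if h = int k then {(c, True)} else {})"
    by (auto simp: on_line_def meets_bigger_def algebra_simps)
qed

text \<open>A discrete intermediate value theorem: heights change by one at each step.\<close>

lemma path_reaches_height:
  assumes "l \<le> h" "h + height P \<le> l"
  shows "\<exists>ys zs. P = ys @ zs \<and> h + height ys = l"
  using assms
proof (induction P arbitrary: h)
  case (Cons s P)
  show ?case
  proof (cases "h = l")
    case True
    then have "s # P = [] @ s # P \<and> h + height [] = l" by simp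
    then show ?thesis by blast
  next
    case False
    have "l \<le> h + height [s]" using Cons.prems False by (cases s) auto
    moreover have "h + height [s] + height P \<le> l" using Cons.prems by (cases s) auto
    ultimately obtain ys zs where "P = ys @ zs" "h + height [s] + height ys = l"
      using Cons.IH by blast
    then have "s # P = (s # ys) @ zs \<and> h + height (s # ys) = l"
      using height_Cons[of s ys] by simp
    then show ?thesis by blast
  qed
qed simp

text \<open>Take the shortest prefix at which the event occurs. This provides the minimality clause
  in the search of \<open>insert_marked\<close>.\<close>

lemma first_split:
  assumes "P = ys @ zs" "E ys zs"
  shows "\<exists>ys' zs'. P = ys' @ zs' \<and> E ys' zs' \<and>
    (\<forall>ys1 ys2. ys' = ys1 @ ys2 \<and> ys2 \<noteq> [] \<longrightarrow> \<not> E ys1 (ys2 @ zs'))"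
proof -
  let ?F = "\<lambda>n. \<exists>ys zs. P = ys @ zs \<and> E ys zs \<and> length ys = n"
  have ex: "\<exists>n. ?F n" using assms by blast
  from LeastI_ex[OF ex] obtain ys' zs' where
    *: "P = ys' @ zs'" "E ys' zs'" "length ys' = (LEAST n. ?F n)" by blast
  have "\<not> E ys1 (ys2 @ zs')" if "ys' = ys1 @ ys2" "ys2 \<noteq> []" for ys1 ys2
  proof
    assume E: "E ys1 (ys2 @ zs')"
    have "P = ys1 @ ys2 @ zs'" using that(1) *(1) by simp
    then have "(LEAST n. ?F n) \<le> length ys1" using E by (intro Least_le) blast
    moreover have "length ys' = length ys1 + length ys2" "0 < length ys2" using that by simp_all
    ultimately show False using *(3) by linarith
  qed
  with * show ?thesis by blast
qed

text \<open>Any admissible starting car suffices, because its search always ends: right after its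
  North step the path is at height \<open>k + 1\<close> or \<open>k + 2\<close>, and it finishes at
  height 0, so it meets the line at height \<open>k\<close>.\<close>

lemma insert_marked_nonempty_iff:
  assumes c: "c \<notin> cars P" and marked: "\<forall>(d, m) \<in> diagonal P (int k). \<not> (m \<and> d < c)"
    and height: "height P = 0"
  shows "insert_marked P c k \<noteq> {} \<longleftrightarrow>
    (\<exists>s. (s, False) \<in> diagonal P (int k) \<and> s < c) \<or>
    (\<exists>b. (b, False) \<in> diagonal P (int k + 1) \<and> c < b)" (is "_ \<longleftrightarrow> ?R")
proof
  assume "insert_marked P c k \<noteq> {}"
  then obtain xs a ws where "P = xs @ North a False # ws"
      "height xs = int k \<and> a < c \<or> height xs = int k + 1 \<and> c < a"
    unfolding insert_marked_def by (auto split: if_split_asm)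
  then show ?R unfolding diagonal_def by blast
next
  assume ?R
  then obtain xs a ws where P: "P = xs @ North a False # ws"
    and a: "height xs = int k \<and> a < c \<or> height xs = int k + 1 \<and> c < a"
    unfolding diagonal_def by blast
  \<comment> \<open>Both stopping events are merged, so that the first occurrence is minimal for
    either of them.\<close>
  let ?E = "\<lambda>ys zs. meets_bigger c k (xs @ North a False # ys) zs \<or> on_line k (xs @ North a False # ys)"
  have "int k \<le> height xs + 1" "height xs + 1 + height ws \<le> int k"
    using a P height by auto
  then obtain ys zs where "ws = ys @ zs" "height xs + 1 + height ys = int k"
    using path_reaches_height by blast
  then have "ws = ys @ zs" "?E ys zs" by (auto simp: on_line_def)
  then have "\<exists>ys zs. ws = ys @ zs \<and> ?E ys zs \<and>
      (\<forall>ys1 ys2. ys = ys1 @ ys2 \<and> ys2 \<noteq> [] \<longrightarrow> \<not> ?E ys1 (ys2 @ zs))"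
    by (rule first_split[where E = ?E])
  then obtain ys zs where ws: "ws = ys @ zs" "?E ys zs"
    "\<forall>ys1 ys2. ys = ys1 @ ys2 \<and> ys2 \<noteq> [] \<longrightarrow> \<not> ?E ys1 (ys2 @ zs)"
    by blast
  define us where "us = xs @ North a False # ys"
  have "P = us @ zs \<and> us = xs @ North a False # ys \<and>
              (height xs = int k \<and> a < c \<or> height xs = int k + 1 \<and> c < a) \<and>
              (meets_bigger c k us zs \<or> on_line k us) \<and>
              (\<forall>ys1 ys2. ys = ys1 @ ys2 \<and> ys2 \<noteq> [] \<longrightarrow>
                 \<not> meets_bigger c k (xs @ North a False # ys1) (ys2 @ zs) \<and>
                 \<not> on_line k (xs @ North a False # ys1))"
    using P a ws us_def by (simp del: not_ex) blast
  then have "us @ (if on_line k us then [North c True, East] else [East, North c True]) @ zs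
      \<in> insert_marked P c k"
    unfolding insert_marked_def if_P[OF conjI[OF c marked]] mem_Collect_eq by blast
  then show "insert_marked P c k \<noteq> {}" by blast
qed

section \<open>Insertability in terms of run indices\<close>

lemma insert_all_Nil [simp]: "insert_all ins K [] S = S"
  by (simp add: insert_all_def)

text \<open>Cars are processed from right to left, so the leftmost one is inserted last and
  induction on the list peels off the final insertion.\<close>

lemma insert_all_rev_Cons:
  "insert_all ins K (rev (c # cs)) S = (\<Union>P \<in> insert_all ins K (rev cs) S. ins P c (K c))"
  by (simp add: insert_all_def)

text \<open>The three cases of the unmarked insertion, when the diagonal of every car is given by
  \<open>K\<close> and \<open>U\<close> is the set of cars available.\<close>

definition unmarked_linked :: "(nat \<Rightarrow> nat) \<Rightarrow> nat set \<Rightarrow> nat \<Rightarrow> bool" where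
  "unmarked_linked K U c \<longleftrightarrow> K c = 0 \<or> (\<exists>d\<in>U. K d = K c \<and> c < d \<or> K d + 1 = K c \<and> d < c)"

text \<open>Existence of a starting car for the marked insertion, with \<open>U\<close> the unmarked
  cars.\<close>

definition marked_linked :: "(nat \<Rightarrow> nat) \<Rightarrow> nat set \<Rightarrow> nat \<Rightarrow> bool" where
  "marked_linked K U c \<longleftrightarrow> (\<exists>d\<in>U. K d = K c \<and> d < c \<or> K d = K c + 1 \<and> c < d)"

text \<open>A car to the left of \<open>d\<close> has a larger index, or the same index and a
  smaller value, and so never serves \<open>d\<close>. Therefore the cars inserted before
  \<open>d\<close> may be replaced by all unmarked cars.\<close>

lemma unmarked_linked_insert_iff:
  assumes "reading_order K c d"
  shows "unmarked_linked K (insert c U) d \<longleftrightarrow> unmarked_linked K U d"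
  using assms by (auto simp: unmarked_linked_def reading_order_def)

lemma unmarked_linked_insert_self [simp]:
  "unmarked_linked K (insert c U) c \<longleftrightarrow> unmarked_linked K U c"
  by (auto simp: unmarked_linked_def)

text \<open>All paths produced have the same diagonals, so whether the next car fits is the same
  question for each of them.\<close>

lemma insert_all_unmarked_invariant:
  assumes "P \<in> insert_all insert_unmarked K (rev us) {[]}"
  shows "height P = 0 \<and> cars P = set us \<and>
    (\<forall>h. diagonal P h = {(c, False) | c. c \<in> set us \<and> int (K c) = h})"
  using assms
proof (induction us arbitrary: P)
  case (Cons c us)
  then obtain P' where P': "P' \<in> insert_all insert_unmarked K (rev us) {[]}"
    and P: "P \<in> insert_unmarked P' c (K c)"
    unfolding insert_all_rev_Cons by blast
  show ?case using Cons.IH[OF P'] insert_unmarked_invariant[OF P] by auto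
qed simp

text \<open>The reading order guarantees the hypotheses of each insertion: the cars already present
  have index at most \<open>K c\<close>, and those of equal index are larger than
  \<open>c\<close>.\<close>

lemma insert_all_unmarked_nonempty_iff:
  assumes "distinct us" "sorted_wrt (reading_order K) us"
  shows "insert_all insert_unmarked K (rev us) {[]} \<noteq> {} \<longleftrightarrow>
    (\<forall>c \<in> set us. unmarked_linked K (set us) c)"
  using assms
proof (induction us)
  case (Cons c us)
  let ?S = "insert_all insert_unmarked K (rev us) {[]}"
  have ro: "\<forall>d \<in> set us. reading_order K c d" using Cons.prems by simp
  have "insert_unmarked P c (K c) \<noteq> {} \<longleftrightarrow> unmarked_linked K (set us) c" if "P \<in> ?S" for P
  proof -
    have inv: "cars P = set us"
      "diagonal P h = {(c, False) | c. c \<in> set us \<and> int (K c) = h}" for h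
      using insert_all_unmarked_invariant[OF that] by auto
    have "insert_unmarked P c (K c) \<noteq> {} \<longleftrightarrow>
      K c = 0 \<or> (\<exists>s m. (s, m) \<in> diagonal P (int (K c) - 1) \<and> s < c) \<or>
      (\<exists>b m. (b, m) \<in> diagonal P (int (K c)) \<and> c < b)"
      using ro Cons.prems by (intro insert_unmarked_nonempty_iff) (auto simp: inv reading_order_def)
    also have "\<dots> \<longleftrightarrow> unmarked_linked K (set us) c"
    proof -
      have "int (K d) = int (K c) - 1 \<longleftrightarrow> K d + 1 = K c" for d by linarith
      then show ?thesis by (auto simp: inv unmarked_linked_def)
    qed
    finally show ?thesis .
  qed
  then have "insert_all insert_unmarked K (rev (c # us)) {[]} \<noteq> {} \<longleftrightarrow>
      ?S \<noteq> {} \<and> unmarked_linked K (set us) c"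
    unfolding insert_all_rev_Cons by blast
  then show ?case using Cons ro by (auto simp: unmarked_linked_insert_iff)
qed simp

lemma insert_all_marked_invariant:
  assumes "P \<in> insert_all insert_marked K (rev ms) S"
    and "\<forall>P \<in> S. height P = 0 \<and> cars P = U \<and>
      (\<forall>h. diagonal P h = {(c, False) | c. c \<in> U \<and> int (K c) = h})"
  shows "height P = 0 \<and> cars P = U \<union> set ms \<and>
    (\<forall>h. diagonal P h = {(c, False) | c. c \<in> U \<and> int (K c) = h} \<union>
      {(c, True) | c. c \<in> set ms \<and> int (K c) = h})"
  using assms(1)
proof (induction ms arbitrary: P)
  case Nil
  then show ?case using assms(2) by simp
next
  case (Cons c ms)
  then obtain P' where P': "P' \<in> insert_all insert_marked K (rev ms) S"
    and P: "P \<in> insert_marked P' c (K c)"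
    unfolding insert_all_rev_Cons by blast
  show ?case using Cons.IH[OF P'] insert_marked_invariant[OF P] by auto
qed

text \<open>Here \<open>U\<close> stays fixed: all unmarked cars are placed beforehand, and marked
  cars never start a search. Marked cars already on the diagonal of \<open>c\<close> are larger by
  the reading order.\<close>

lemma insert_all_marked_nonempty_iff:
  assumes S: "\<forall>P \<in> S. height P = 0 \<and> cars P = U \<and>
      (\<forall>h. diagonal P h = {(c, False) | c. c \<in> U \<and> int (K c) = h})"
    and "distinct ms" "set ms \<inter> U = {}" "sorted_wrt (reading_order K) ms"
  shows "insert_all insert_marked K (rev ms) S \<noteq> {} \<longleftrightarrow>
    S \<noteq> {} \<and> (\<forall>c \<in> set ms. marked_linked K U c)"
  using assms(2-4)
proof (induction ms)
  case (Cons c ms)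
  let ?S = "insert_all insert_marked K (rev ms) S"
  have ro: "\<forall>d \<in> set ms. reading_order K c d" using Cons.prems by simp
  have "insert_marked P c (K c) \<noteq> {} \<longleftrightarrow> marked_linked K U c" if "P \<in> ?S" for P
  proof -
    have inv: "height P = 0" "cars P = U \<union> set ms"
      "diagonal P h = {(c, False) | c. c \<in> U \<and> int (K c) = h} \<union>
        {(c, True) | c. c \<in> set ms \<and> int (K c) = h}" for h
      using insert_all_marked_invariant[OF that S] by auto
    have "insert_marked P c (K c) \<noteq> {} \<longleftrightarrow>
      (\<exists>s. (s, False) \<in> diagonal P (int (K c)) \<and> s < c) \<or>
      (\<exists>b. (b, False) \<in> diagonal P (int (K c) + 1) \<and> c < b)"
      using ro Cons.prems by (intro insert_marked_nonempty_iff) (auto simp: inv reading_order_def)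
    also have "\<dots> \<longleftrightarrow> marked_linked K U c"
    proof -
      have "int (K d) = int (K c) + 1 \<longleftrightarrow> K d = K c + 1" for d by linarith
      then show ?thesis by (auto simp: inv marked_linked_def)
    qed
    finally show ?thesis .
  qed
  then have "insert_all insert_marked K (rev (c # ms)) S \<noteq> {} \<longleftrightarrow>
      ?S \<noteq> {} \<and> marked_linked K U c"
    unfolding insert_all_rev_Cons by blast
  then show ?case using Cons by auto
qed simp

section \<open>Linking conditions on a whole marked word\<close>

definition unmarked_cars :: "marked_word \<Rightarrow> nat set" where
  "unmarked_cars t = {c. (c, False) \<in> set t}"

definition marked_cars :: "marked_word \<Rightarrow> nat set" where
  "marked_cars t = {c. (c, True) \<in> set t}"

lemma insertable_iff_linked:
  fixes t :: marked_word
  assumes "distinct (map fst t)"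
  defines "K \<equiv> run_from_end (map fst t)"
  shows "insertable t \<longleftrightarrow>
    (\<forall>c \<in> unmarked_cars t. unmarked_linked K (unmarked_cars t) c) \<and>
    (\<forall>c \<in> marked_cars t. marked_linked K (unmarked_cars t) c)"
proof -
  define us ms where "us = map fst (filter (\<lambda>x. \<not> snd x) t)" and "ms = map fst (filter snd t)"
  have sets: "set us = unmarked_cars t" "set ms = marked_cars t"
    by (force simp: us_def ms_def unmarked_cars_def marked_cars_def)+
  have dist: "distinct us" "distinct ms"
    using assms(1) by (simp_all add: us_def ms_def distinct_map_filter)
  have disj: "set ms \<inter> set us = {}"
    unfolding sets unmarked_cars_def marked_cars_def
    using eq_key_imp_eq_value[OF assms(1)] by blast
  have "sorted_wrt (reading_order K) (map fst t)"
    unfolding K_def using assms(1) by (rule reading_order_run_from_end)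
  then have sorted: "sorted_wrt (reading_order K) us" "sorted_wrt (reading_order K) ms"
    by (simp_all add: us_def ms_def sorted_wrt_map sorted_wrt_filter)
  have "insertable t \<longleftrightarrow>
      insert_all insert_marked K (rev ms) (insert_all insert_unmarked K (rev us) {[]}) \<noteq> {}"
    by (simp add: insertable_def insertion_result_def Let_def K_def us_def ms_def)
  also have "\<dots> \<longleftrightarrow> insert_all insert_unmarked K (rev us) {[]} \<noteq> {} \<and>
      (\<forall>c \<in> set ms. marked_linked K (set us) c)"
    using insert_all_unmarked_invariant dist disj sorted
    by (intro insert_all_marked_nonempty_iff) blast+
  finally show ?thesis
    using insert_all_unmarked_nonempty_iff dist sorted sets by simp
qed

text \<open>An unmarked car serving a marked car must stand to its left, which excludes a marked
  first entry. Conversely, the nearest unmarked car \<open>x\<close> to the left of a marked car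
  \<open>c\<close> serves it, because \<open>x\<close> itself is linked to a car beyond
  \<open>c\<close>.\<close>

lemma marked_linked_iff_first_unmarked:
  assumes order: "sorted_wrt (reading_order K) (map fst t)"
    and unmarked: "\<forall>c \<in> unmarked_cars t. unmarked_linked K (unmarked_cars t) c"
  shows "(\<forall>c \<in> marked_cars t. marked_linked K (unmarked_cars t) c) \<longleftrightarrow>
    (t = [] \<or> \<not> snd (hd t))"
proof
  assume marked: "\<forall>c \<in> marked_cars t. marked_linked K (unmarked_cars t) c"
  show "t = [] \<or> \<not> snd (hd t)"
  proof (rule ccontr)
    assume "\<not> ?thesis"
    then obtain c t' where t: "t = (c, True) # t'" by (cases t) auto
    then obtain d where "(d, False) \<in> set t'" "K d = K c \<and> d < c \<or> K d = K c + 1 \<and> c < d"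
      using marked by (auto simp: marked_cars_def unmarked_cars_def marked_linked_def)
    moreover from this have "reading_order K c d" using order t by force
    ultimately show False by (auto simp: reading_order_def)
  qed
next
  assume first: "t = [] \<or> \<not> snd (hd t)"
  show "\<forall>c \<in> marked_cars t. marked_linked K (unmarked_cars t) c"
  proof
    fix c assume "c \<in> marked_cars t"
    then obtain A E where t: "t = A @ (c, True) # E"
      unfolding marked_cars_def by (auto dest: split_list)
    then have "\<exists>y \<in> set A. \<not> snd y" using first by (cases A) auto
    \<comment> \<open>The last unmarked car before \<open>c\<close>; only marked cars lie between
      them.\<close>
    then obtain A' x C where A: "A = A' @ (x, False) # C" and C: "\<forall>y \<in> set C. snd y"
      using split_list_last_prop[of A "\<lambda>y. \<not> snd y"] by auto
    have x: "x \<in> unmarked_cars t" using t A by (simp add: unmarked_cars_def)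
    have xc: "reading_order K x c" using order t A by (auto simp: sorted_wrt_append)
    show "marked_linked K (unmarked_cars t) c"
    proof (cases "K x = K c")
      case True
      then show ?thesis using x xc unfolding marked_linked_def reading_order_def by auto
    next
      case False
      then have less: "K c < K x" using xc by (auto simp: reading_order_def)
      then obtain d where d: "(d, False) \<in> set t"
        "K d = K x \<and> x < d \<or> K d + 1 = K x \<and> d < x"
        using unmarked x unfolding unmarked_linked_def unmarked_cars_def by auto
      have "(d, False) \<notin> set A'"
      proof
        assume "(d, False) \<in> set A'"
        then have "reading_order K d x" using order t A by (force simp: sorted_wrt_append)
        then show False using d by (auto simp: reading_order_def)
      qed
      then have "(d, False) \<in> set E" using d t A C by auto
      then have "reading_order K c d" using order t by (force simp: sorted_wrt_append)
      \<comment> \<open>Since \<open>d\<close> stands to the right of \<open>c\<close>,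
        \<open>K d \<le> K c < K x\<close>. The link of \<open>x\<close> leaves only
        \<open>K d + 1 = K x\<close>, so \<open>c\<close> and \<open>d\<close> share a run and
        \<open>c < d < x\<close>.\<close>
      then have "K x = K c + 1 \<and> c < x" using d less by (auto simp: reading_order_def)
      then show ?thesis using x by (auto simp: marked_linked_def)
    qed
  qed
qed

section \<open>Segments\<close>

text \<open>The indices are those of the word itself, so that the predicate applies to
  suffixes.\<close>

definition all_unmarked_linked :: "marked_word \<Rightarrow> bool" where
  "all_unmarked_linked t \<longleftrightarrow>
    (\<forall>c \<in> unmarked_cars t. unmarked_linked (run_from_end (map fst t)) (unmarked_cars t) c)"

lemma unmarked_linked_cong:
  assumes "\<And>d. d \<in> insert c U \<Longrightarrow> K d = K' d"
  shows "unmarked_linked K U c \<longleftrightarrow> unmarked_linked K' U c"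
  using assms by (auto simp: unmarked_linked_def)

lemma unmarked_cars_Cons:
  "unmarked_cars ((x, m) # t) = (if m then unmarked_cars t else insert x (unmarked_cars t))"
  by (auto simp: unmarked_cars_def)

lemma unmarked_cars_subset: "unmarked_cars t \<subseteq> set (map fst t)"
  by (force simp: unmarked_cars_def)

text \<open>Deleting the first letter changes no other run index, and that letter serves no car to
  its right.\<close>

lemma all_unmarked_linked_Cons:
  assumes "distinct (map fst ((x, m) # t))"
  shows "all_unmarked_linked ((x, m) # t) \<longleftrightarrow> all_unmarked_linked t \<and>
    (m \<or> unmarked_linked (run_from_end (x # map fst t)) (unmarked_cars t) x)"
proof -
  let ?K = "run_from_end (x # map fst t)" and ?K' = "run_from_end (map fst t)"
  have K: "?K d = ?K' d" if "d \<in> unmarked_cars t" for d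
    using run_from_end_append[of "[x]" "map fst t" d] assms that unmarked_cars_subset[of t] by auto
  have ro: "reading_order ?K x d" if "d \<in> unmarked_cars t" for d
    using reading_order_run_from_end[OF assms] that by (force simp: unmarked_cars_def)
  have "unmarked_linked ?K (unmarked_cars t) d \<longleftrightarrow> unmarked_linked ?K' (unmarked_cars t) d"
    if "d \<in> unmarked_cars t" for d
    using K that by (intro unmarked_linked_cong) auto
  then show ?thesis
    using ro by (auto simp: all_unmarked_linked_def unmarked_cars_Cons unmarked_linked_insert_iff)
qed

lemma all_unmarked_linked_marked_prefix:
  assumes "distinct (map fst (map (\<lambda>y. (y, True)) xs @ t))"
  shows "all_unmarked_linked (map (\<lambda>y. (y, True)) xs @ t) \<longleftrightarrow> all_unmarked_linked t"
  using assms by (induction xs) (auto simp: all_unmarked_linked_Cons)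

lemma unmarked_cars_marked_prefix [simp]:
  "unmarked_cars (map (\<lambda>y. (y, True)) xs @ t) = unmarked_cars t"
  by (auto simp: unmarked_cars_def)

text \<open>The arrangement of a block \<open>B\<close> in front of a word \<open>w\<close>; the
  empty word stands for the case of the last block, which has its own equation in
  \<open>segments\<close>.\<close>

definition segment_order :: "nat list \<Rightarrow> nat set \<Rightarrow> nat list" where
  "segment_order w B = (if w = [] then sorted_list_of_set B else
     sorted_list_of_set {x \<in> B. hd w < x} @ sorted_list_of_set {x \<in> B. x < hd w})"

lemma sorted_list_of_set_eqI: "sorted_wrt (<) xs \<Longrightarrow> set xs = A \<Longrightarrow> sorted_list_of_set A = xs"
  for xs :: "nat list"
  using sorted_list_of_set.idem_if_sorted_distinct strict_sorted_iff by blast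

lemma segment_order_eqI:
  assumes "sorted_wrt (<) p" "sorted_wrt (<) q" "\<forall>y \<in> set p. r < y" "\<forall>y \<in> set q. y < r"
  shows "segment_order (r # w) (set (p @ q)) = p @ q"
proof -
  have "sorted_list_of_set {x \<in> set (p @ q). r < x} = p"
    using assms by (intro sorted_list_of_set_eqI) auto
  moreover have "sorted_list_of_set {x \<in> set (p @ q). x < r} = q"
    using assms by (intro sorted_list_of_set_eqI) auto
  ultimately show ?thesis by (simp add: segment_order_def)
qed

text \<open>Only the next unmarked car \<open>r\<close> matters. No break up to \<open>r\<close>
  means an increasing segment below \<open>r\<close>; one break together with \<open>r < x\<close>
  means an increasing part above \<open>r\<close>, then one below \<open>r\<close>. These are the
  shapes given by \<open>segment_order\<close>. Without a next car, the link says that the segment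
  is increasing.\<close>

lemma first_unmarked_linked_iff:
  assumes dist: "distinct (x # xs @ map fst t)" and t: "t = [] \<or> \<not> snd (hd t)"
  shows "unmarked_linked (run_from_end (x # xs @ map fst t)) (unmarked_cars t) x \<longleftrightarrow>
    segment_order (map fst t) (set (x # xs)) = x # xs"
proof (cases t)
  case Nil
  have "unmarked_linked (run_from_end (x # xs @ map fst t)) (unmarked_cars t) x \<longleftrightarrow>
      descents (x # xs) = 0"
    using Nil run_from_end_eq_descents[of "[]" x xs] dist
    by (simp add: unmarked_linked_def unmarked_cars_def)
  also have "\<dots> \<longleftrightarrow> sorted_wrt (<) (x # xs)" by (rule descents_eq_0_iff) simp
  also have "\<dots> \<longleftrightarrow> segment_order (map fst t) (set (x # xs)) = x # xs"
  proof
    assume "segment_order (map fst t) (set (x # xs)) = x # xs"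
    then have "sorted_list_of_set (set (x # xs)) = x # xs" using Nil by (simp only: segment_order_def) simp
    then show "sorted_wrt (<) (x # xs)" using strict_sorted_list_of_set by metis
  next
    assume "sorted_wrt (<) (x # xs)"
    then have "sorted_list_of_set (set (x # xs)) = x # xs" by (intro sorted_list_of_set_eqI) auto
    then show "segment_order (map fst t) (set (x # xs)) = x # xs"
      using Nil by (simp only: segment_order_def) simp
  qed
  finally show ?thesis .
next
  case (Cons z t')
  then obtain r where t': "t = (r, False) # t'" using t by (cases z) auto
  define w where "w = map fst t'"
  let ?K = "run_from_end (x # xs @ map fst t)"
  have w: "map fst t = r # w" by (simp add: t' w_def)
  have Kx: "?K x = descents ((x # xs) @ r # w)"
    using run_from_end_eq_descents[of "[]" x "xs @ r # w"] dist w by simp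
  have Kr: "?K r = descents (r # w)"
    using run_from_end_eq_descents[of "x # xs" r w] dist w by simp
  have r: "r \<in> unmarked_cars t" by (simp add: t' unmarked_cars_def)
  have le: "?K r \<le> ?K x" unfolding Kx Kr by (rule descents_append_ge)
  have eq: "?K x = ?K r \<longleftrightarrow> sorted_wrt (<) ((x # xs) @ [r])"
    unfolding Kx Kr by (rule descents_append_eq_iff)
  have order: "reading_order ?K r d" if "d \<in> unmarked_cars t" "d \<noteq> r" for d
  proof -
    have "sorted_wrt (reading_order ?K) (x # xs @ r # w)"
      using reading_order_run_from_end[OF dist] w by simp
    moreover have "d \<in> set w" using that w unmarked_cars_subset[of t] by auto
    ultimately show ?thesis by (auto simp: sorted_wrt_append)
  qed
  \<comment> \<open>Any car \<open>d\<close> linking \<open>x\<close> satisfies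
    \<open>?K d \<le> ?K r \<le> ?K x\<close>, with \<open>r < d\<close> if \<open>d\<close> differs
    from \<open>r\<close> but has the same index. So if some car links \<open>x\<close>, then
    \<open>r\<close> already does.\<close>
  have "unmarked_linked ?K (unmarked_cars t) x \<longleftrightarrow> ?K x = ?K r \<or> ?K x = ?K r + 1 \<and> r < x"
  proof
    assume L: "unmarked_linked ?K (unmarked_cars t) x"
    show "?K x = ?K r \<or> ?K x = ?K r + 1 \<and> r < x"
    proof (cases "?K x = 0")
      case True
      then show ?thesis using le by simp
    next
      case False
      then obtain d where "d \<in> unmarked_cars t" "?K d = ?K x \<and> x < d \<or> ?K d + 1 = ?K x \<and> d < x"
        using L by (auto simp: unmarked_linked_def)
      then show ?thesis using order[of d] le by (cases "d = r") (auto simp: reading_order_def)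
    qed
  next
    assume "?K x = ?K r \<or> ?K x = ?K r + 1 \<and> r < x"
    moreover have "x < r" if "?K x = ?K r" using eq that by auto
    ultimately show "unmarked_linked ?K (unmarked_cars t) x"
      using r unfolding unmarked_linked_def by metis
  qed
  also have "\<dots> \<longleftrightarrow> segment_order (r # w) (set (x # xs)) = x # xs"
  proof
    assume "?K x = ?K r \<or> ?K x = ?K r + 1 \<and> r < x"
    then show "segment_order (r # w) (set (x # xs)) = x # xs"
    proof (elim disjE conjE)
      assume "?K x = ?K r"
      then have "sorted_wrt (<) ((x # xs) @ [r])" using eq by simp
      then have "sorted_wrt (<) (x # xs)" "\<forall>y \<in> set (x # xs). y < r"
        unfolding sorted_wrt_append by auto
      then show ?thesis using segment_order_eqI[of "[]" "x # xs" r w] by simp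
    next
      assume "?K x = ?K r + 1" and rx: "r < x"
      then obtain p q where pq: "x # xs = p @ q" "p \<noteq> []" "sorted_wrt (<) p" "sorted_wrt (<) (q @ [r])"
        using descents_append_eq_Suc[of "x # xs" r w] Kx Kr by auto
      \<comment> \<open>As \<open>p\<close> is increasing and starts with \<open>x\<close>, the
        inequality \<open>r < x\<close> passes to all of \<open>p\<close>.\<close>
      then obtain p' where p': "p = x # p'" by (cases p) auto
      then have "\<forall>y \<in> set p. r < y" using pq rx by auto
      moreover have "sorted_wrt (<) q" "\<forall>y \<in> set q. y < r" using pq(4) by (auto simp: sorted_wrt_append)
      ultimately show ?thesis using segment_order_eqI[of p q r w] pq by simp
    qed
  next
    assume S: "segment_order (r # w) (set (x # xs)) = x # xs"
    define p q where "p = sorted_list_of_set {y \<in> set (x # xs). r < y}" and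
      "q = sorted_list_of_set {y \<in> set (x # xs). y < r}"
    have xs: "x # xs = p @ q" using S by (simp add: segment_order_def p_def q_def)
    have p: "sorted_wrt (<) p" "\<forall>y \<in> set p. r < y" by (simp_all add: p_def)
    have "sorted_wrt (<) q" "\<forall>y \<in> set q. y < r" by (simp_all add: q_def)
    then have q: "sorted_wrt (<) (q @ [r])" by (simp add: sorted_wrt_append)
    show "?K x = ?K r \<or> ?K x = ?K r + 1 \<and> r < x"
    proof (cases "p = []")
      case True
      then show ?thesis using eq xs q by simp
    next
      case False
      then have "?K x = ?K r + 1"
        using descents_append_single_descent[OF False p q, of w] xs Kx Kr by simp
      moreover have "r < x" using False xs p by (cases p) auto
      ultimately show ?thesis by simp
    qed
  qed
  finally show ?thesis by (simp add: w)
qed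

text \<open>The marked letters \<open>xs\<close> carry no condition and serve no unmarked car, so a
  segment contributes only the condition on \<open>x\<close>.\<close>

lemma all_unmarked_linked_segment:
  assumes "distinct (x # xs @ map fst t)" "t = [] \<or> \<not> snd (hd t)"
  shows "all_unmarked_linked (mark_tail (x # xs) @ t) \<longleftrightarrow>
    all_unmarked_linked t \<and> segment_order (map fst t) (set (x # xs)) = x # xs"
proof -
  have "map fst (map (\<lambda>y. (y, True)) xs @ t) = xs @ map fst t" by (simp add: comp_def)
  then show ?thesis
    using assms first_unmarked_linked_iff[OF assms]
    by (simp add: all_unmarked_linked_Cons all_unmarked_linked_marked_prefix del: map_append)
qed

text \<open>The two halves can only miss the letter \<open>hd w\<close>.\<close>

lemma set_segment_order:
  assumes "finite B" "w = [] \<or> hd w \<notin> B"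
  shows "set (segment_order w B) = B"
proof (cases "w = []")
  case False
  then have "x < hd w \<or> hd w < x" if "x \<in> B" for x using assms(2) that by (metis nat_neq_iff)
  then show ?thesis using assms(1) False by (auto simp: segment_order_def)
qed (simp add: segment_order_def assms(1))

section \<open>Ordered set partitions block by block\<close>

lemma ordered_set_partition_Nil [simp]: "ordered_set_partition A [] \<longleftrightarrow> A = {}"
  by (auto simp: ordered_set_partition_def partition_on_def)

lemma ordered_set_partition_Cons:
  "ordered_set_partition A (B # Bs) \<longleftrightarrow>
    finite A \<and> B \<noteq> {} \<and> B \<subseteq> A \<and> ordered_set_partition (A - B) Bs"
proof
  assume "ordered_set_partition A (B # Bs)"
  then have fin: "finite A" and dist: "B \<notin> set Bs" "distinct Bs" and part: "partition_on A (insert B (set Bs))"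
    by (auto simp: ordered_set_partition_def)
  have "C \<inter> B = {}" if "C \<in> set Bs" for C
    using part dist that by (metis disjointD insertCI partition_onD2)
  then have "\<Union> (set Bs) = A - B" using part by (auto simp: partition_on_def)
  moreover have "disjoint (set Bs)" using part by (auto simp: partition_on_def pairwise_insert)
  ultimately have "partition_on (A - B) (set Bs)" using part by (auto simp: partition_on_def)
  then show "finite A \<and> B \<noteq> {} \<and> B \<subseteq> A \<and> ordered_set_partition (A - B) Bs"
    using fin dist part by (auto simp: ordered_set_partition_def partition_on_def)
next
  assume R: "finite A \<and> B \<noteq> {} \<and> B \<subseteq> A \<and> ordered_set_partition (A - B) Bs"
  then have part: "partition_on (A - B) (set Bs)" "distinct Bs"
    by (auto simp: ordered_set_partition_def)
  have sub: "C \<subseteq> A - B" if "C \<in> set Bs" for C using part(1) that by (auto simp: partition_on_def)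
  have "B \<notin> set Bs" using sub[of B] R by auto
  moreover have "disjoint (insert B (set Bs))"
    using part(1) sub by (force simp: partition_on_def pairwise_insert disjnt_def)
  moreover have "\<Union> (insert B (set Bs)) = A" using part(1) R by (auto simp: partition_on_def)
  ultimately show "ordered_set_partition A (B # Bs)"
    using part R by (auto simp: ordered_set_partition_def partition_on_def)
qed

text \<open>Merges the defining equations: since blocks are nonempty, \<open>tau Bs\<close> is empty
  only when \<open>Bs\<close> is. The assumption on \<open>tau Bs\<close> comes from the induction
  in \<open>set_tau\<close>.\<close>

lemma segments_Cons:
  assumes part: "ordered_set_partition A (B # Bs)" and tau: "set (tau Bs) = A - B"
  shows "segments (B # Bs) = segment_order (tau Bs) B # segments Bs"
    and "set (segment_order (tau Bs) B) = B"
proof -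
  have B: "finite B" and Bs: "ordered_set_partition (A - B) Bs"
    using part by (auto simp: ordered_set_partition_Cons intro: finite_subset)
  show "segments (B # Bs) = segment_order (tau Bs) B # segments Bs"
  proof (cases Bs)
    case (Cons C Cs)
    then have "A - B \<noteq> {}" using Bs by (auto simp: ordered_set_partition_Cons)
    then have "tau (C # Cs) \<noteq> []" using tau Cons by (metis set_empty)
    then show ?thesis
      using Cons by (simp only: segments.simps segment_order_def Let_def tau_def if_False)
  qed (simp add: segment_order_def tau_def)
  have "tau Bs = [] \<or> hd (tau Bs) \<notin> B" using tau by (metis DiffD2 hd_in_set)
  then show "set (segment_order (tau Bs) B) = B" using set_segment_order[OF B] by simp
qed

lemma set_tau: "ordered_set_partition A Bs \<Longrightarrow> set (tau Bs) = A"
proof (induction Bs arbitrary: A)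
  case Nil
  then show ?case by (simp add: tau_def)
next
  case (Cons B Bs)
  then have "B \<subseteq> A" and tau: "set (tau Bs) = A - B" by (auto simp: ordered_set_partition_Cons)
  moreover have "tau (B # Bs) = segment_order (tau Bs) B @ tau Bs"
    using segments_Cons(1)[OF Cons.prems tau] by (simp add: tau_def)
  ultimately show ?case using segments_Cons(2)[OF Cons.prems tau] by auto
qed

lemma tau_star_Cons:
  assumes "ordered_set_partition A (B # Bs)"
  shows "tau_star (B # Bs) = mark_tail (segment_order (tau Bs) B) @ tau_star Bs"
    and "set (segment_order (tau Bs) B) = B"
proof -
  have "set (tau Bs) = A - B" using assms by (auto simp: ordered_set_partition_Cons set_tau)
  note segments_Cons[OF assms this]
  then show "tau_star (B # Bs) = mark_tail (segment_order (tau Bs) B) @ tau_star Bs"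
    "set (segment_order (tau Bs) B) = B" by (simp_all add: tau_star_def)
qed

section \<open>Linked words are the words of ordered set partitions\<close>

lemma map_fst_mark_tail [simp]: "map fst (mark_tail xs) = xs"
  by (cases xs) (simp_all add: comp_def)

text \<open>Blocks are peeled off one at a time; each is nonempty, so its segment starts with an
  unmarked entry, and it is in \<open>segment_order\<close> by construction.\<close>

lemma tau_star_linked:
  assumes "ordered_set_partition A Bs" "distinct (map fst (tau_star Bs))"
  shows "(tau_star Bs = [] \<or> \<not> snd (hd (tau_star Bs))) \<and> all_unmarked_linked (tau_star Bs)"
  using assms
proof (induction Bs arbitrary: A)
  case Nil
  then show ?case by (simp add: tau_star_def all_unmarked_linked_def unmarked_cars_def)
next
  case (Cons B Bs)
  note B = tau_star_Cons[OF Cons.prems(1)]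
  have "B \<noteq> {}" "ordered_set_partition (A - B) Bs"
    using Cons.prems(1) by (auto simp: ordered_set_partition_Cons)
  then obtain x xs where x: "segment_order (tau Bs) B = x # xs"
    using B(2) by (metis list.exhaust list.set(1))
  have dist: "distinct (x # xs @ map fst (tau_star Bs))"
    using Cons.prems(2) unfolding B(1) x map_append map_fst_mark_tail by simp
  then have IH: "tau_star Bs = [] \<or> \<not> snd (hd (tau_star Bs))" "all_unmarked_linked (tau_star Bs)"
    using Cons.IH[OF \<open>ordered_set_partition (A - B) Bs\<close>] by simp_all
  have "segment_order (map fst (tau_star Bs)) (set (x # xs)) = x # xs"
    using x B(2) by (simp add: map_fst_tau_star del: list.set)
  then have "all_unmarked_linked (tau_star (B # Bs))"
    unfolding B(1) x using all_unmarked_linked_segment[OF dist IH(1)] IH(2) by simp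
  then show ?case unfolding B(1) x by simp
qed

text \<open>The blocks are read off the marks: each consists of an unmarked entry and the marked
  entries up to the next unmarked one.\<close>

lemma linked_imp_tau_star:
  assumes "distinct (map fst t)" "t = [] \<or> \<not> snd (hd t)" "all_unmarked_linked t"
  shows "\<exists>Bs. ordered_set_partition (set (map fst t)) Bs \<and> t = tau_star Bs"
  using assms
proof (induction t rule: length_induct)
  case (1 t)
  show ?case
  proof (cases t)
    case Nil
    then show ?thesis by (intro exI[of _ "[]"]) (simp add: tau_star_def)
  next
    case (Cons z u)
    then obtain x where t: "t = (x, False) # u" using 1 by (cases z) auto
    define xs t' where "xs = map fst (takeWhile snd u)" and "t' = dropWhile snd u"
    have "takeWhile snd u = map (\<lambda>y. (y, True)) xs"
      unfolding xs_def map_map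
      by (rule map_idI[symmetric]) (metis comp_apply prod.collapse set_takeWhileD)
    then have t_eq: "t = mark_tail (x # xs) @ t'"
      using t takeWhile_dropWhile_id[of snd u] by (simp add: t'_def)
    have hd: "t' = [] \<or> \<not> snd (hd t')" unfolding t'_def using hd_dropWhile by blast
    have map: "map fst t = x # xs @ map fst t'"
      unfolding t_eq map_append map_fst_mark_tail by simp
    then have dist: "distinct (x # xs @ map fst t')" using 1 by simp
    have "length t' < length t" by (simp add: t_eq)
    moreover have link: "all_unmarked_linked t'" "segment_order (map fst t') (set (x # xs)) = x # xs"
      using all_unmarked_linked_segment[OF dist hd] 1 t_eq by auto
    moreover have "distinct (map fst t')" using dist by simp
    ultimately obtain Bs where Bs: "ordered_set_partition (set (map fst t')) Bs" "t' = tau_star Bs"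
      using 1 hd by blast
    have "set (map fst t) - set (x # xs) = set (map fst t')" using dist unfolding map by auto
    then have part: "ordered_set_partition (set (map fst t)) (set (x # xs) # Bs)"
      using Bs(1) map by (auto simp: ordered_set_partition_Cons simp del: set_map)
    moreover have "t = tau_star (set (x # xs) # Bs)"
      using tau_star_Cons(1)[OF part] link(2) Bs(2) t_eq by (metis map_fst_tau_star)
    ultimately show ?thesis by blast
  qed
qed

theorem theorem3p11:
  fixes t :: marked_word
  assumes "marked_permutation t"
  shows "insertable t \<longleftrightarrow>
    (\<exists>Bs. ordered_set_partition (set (map fst t)) Bs \<and> t = tau_star Bs)"
proof -
  have dist: "distinct (map fst t)" using assms by (simp add: marked_permutation_def)
  \<comment> \<open>The condition on marked cars reduces to the first entry only in the presence of
    the condition on unmarked ones, so the conjunction is rewritten as a whole.\<close>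
  have "insertable t \<longleftrightarrow> all_unmarked_linked t \<and> (t = [] \<or> \<not> snd (hd t))"
    using insertable_iff_linked[OF dist]
      marked_linked_iff_first_unmarked[OF reading_order_run_from_end[OF dist]]
    unfolding all_unmarked_linked_def by blast
  then show ?thesis using linked_imp_tau_star[OF dist] tau_star_linked dist by blast
qed

end
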